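(* Consider a QoS satisfaction game $(\mathcal{N},\mathcal{C},(T_n^c)_{n\in\mathcal{N},c\in\mathcal{C}})$ with $N$ players, where $T_n^c\ge 1$ for each player $n\in\mathcal{N}$ and each channel $c\in\mathcal{C}$. Then the price of anarchy of this game satisfies $$\mathrm{PoA}\le \min\left\{N,\ \frac{\max\{T_n^c:n\in\mathcal{N},c\in\mathcal{C}\}}{\min\{T_n^c:n\in\mathcal{N},c\in\mathcal{C}\}}\right\}.$$
   Context: A QoS satisfaction game in interference threshold form is $(\mathcal{N},\mathcal{C},(T_n^c)_{n\in\mathcal{N},c\in\mathcal{C}})$ with players (users) $\mathcal{N}=\{1,\ldots,N\}$, channels $\mathcal{C}=\{1,\ldots,C\}$ and integer thresholds $T_n^c\in\{0,1,\ldots,N+1\}$. Each player's strategy set is $\tilde{\mathcal{C}}=\{0,1,\ldots,C\}$, where $0$ is the dormant state. A strategy profile is $\boldsymbol{x}=(x_1,\ldots,x_N)\in\tilde{\mathcal{C}}^N$. The congestion level of channel $c$ is $I^c(\boldsymbol{x})=|\{n\in\mathcal{N}:x_n=c\}|$. The utility of player $n$ is $U_n(\boldsymbol{x})=1$ if $x_n\ne0$ and $I^{x_n}(\boldsymbol{x})\le T_n^{x_n}$, $U_n(\boldsymbol{x})=0$ if $x_n=0$, and $U_n(\boldsymbol{x})=-1$ if $x_n\neq0$ and $I^{x_n}(\boldsymbol{x})>T_n^{x_n}$. A strategy profile is a pure Nash equilibrium if no player can strictly increase its utility by unilaterally changing its strategy to another element of $\tilde{\mathcal{C}}$. Let $\Xi\subseteq\tilde{\mathcal{C}}^N$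 be the set of pure Nash equilibria (it is non-empty). The price of anarchy is $$\mathrm{PoA}=\frac{\max\{\sum_{n=1}^N U_n(\boldsymbol{x}):\boldsymbol{x}\in\tilde{\mathcal{C}}^N\}}{\min\{\sum_{n=1}^N U_n(\boldsymbol{x}):\boldsymbol{x}\in\Xi\}}.$$ *)

theory Defs
  imports Complex_Main "HOL-Library.FuncSet"
begin

text \<open>
  A game is given by the number N of players, the number C of channels and the thresholds
  \<open>T n c\<close>. Players are \<open>1, ..., N\<close>, channels are \<open>1, ..., C\<close>, and strategy 0 is the dormant
  state. Values of T outside these ranges are irrelevant.
\<close>

definition qos_game :: "nat \<Rightarrow> nat \<Rightarrow> (nat \<Rightarrow> nat \<Rightarrow> nat) \<Rightarrow> bool" where
  "qos_game N C T \<longleftrightarrow>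
     1 \<le> N \<and> 1 \<le> C \<and> (\<forall>n\<in>{1..N}. \<forall>c\<in>{1..C}. T n c \<in> {0..N + 1})"

text \<open>
  Profiles are extensional functions, so that there are exactly \<open>(C + 1) ^ N\<close> of them and the
  maximum and minimum in the price of anarchy range over finite sets.
\<close>

definition profiles :: "nat \<Rightarrow> nat \<Rightarrow> (nat \<Rightarrow> nat) set" where
  "profiles N C = {1..N} \<rightarrow>\<^sub>E {0..C}"

definition congestion :: "nat \<Rightarrow> (nat \<Rightarrow> nat) \<Rightarrow> nat \<Rightarrow> nat" where
  "congestion N x c = card {n \<in> {1..N}. x n = c}"

definition utility :: "nat \<Rightarrow> (nat \<Rightarrow> nat \<Rightarrow> nat) \<Rightarrow> (nat \<Rightarrow> nat) \<Rightarrow> nat \<Rightarrow> int" where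
  "utility N T x n =
     (if x n = 0 then 0
      else if congestion N x (x n) \<le> T n (x n) then 1
      else -1)"

definition welfare :: "nat \<Rightarrow> (nat \<Rightarrow> nat \<Rightarrow> nat) \<Rightarrow> (nat \<Rightarrow> nat) \<Rightarrow> int" where
  "welfare N T x = (\<Sum>n\<in>{1..N}. utility N T x n)"

definition nash_equilibria :: "nat \<Rightarrow> nat \<Rightarrow> (nat \<Rightarrow> nat \<Rightarrow> nat) \<Rightarrow> (nat \<Rightarrow> nat) set" where
  "nash_equilibria N C T =
     {x \<in> profiles N C.
        \<not> (\<exists>n\<in>{1..N}. \<exists>s\<in>{0..C}. utility N T (x(n := s)) n > utility N T x n)}"

definition price_of_anarchy :: "nat \<Rightarrow> nat \<Rightarrow> (nat \<Rightarrow> nat \<Rightarrow> nat) \<Rightarrow> real" where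
  "price_of_anarchy N C T =
     real_of_int (Max (welfare N T ` profiles N C)) /
     real_of_int (Min (welfare N T ` nash_equilibria N C T))"

definition thresholds :: "nat \<Rightarrow> nat \<Rightarrow> (nat \<Rightarrow> nat \<Rightarrow> nat) \<Rightarrow> nat set" where
  "thresholds N C T = {T n c | n c. n \<in> {1..N} \<and> c \<in> {1..C}}"

end

theory Submission
  imports Defs
begin

text \<open>
  In an equilibrium nobody is unsatisfied, so its welfare counts the active players. Either
  everybody is active, and the welfare is \<open>N\<close>, or a dormant player finds every channel filled to at
  least the minimal threshold \<open>m\<close>, and the welfare is at least \<open>C * m\<close>. Conversely, a channel
  with a satisfied user has at most \<open>M\<close> users, \<open>M\<close> the maximal threshold, so that no profile has
  welfare above \<open>min N (C * M)\<close>. Equilibria exist because the game has a Rosenthal-type potential.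
\<close>

lemma finite_profiles: "finite (profiles N C)"
  unfolding profiles_def by (intro finite_PiE) auto

lemma profiles_update:
  assumes "x \<in> profiles N C" "n \<in> {1..N}" "s \<in> {0..C}"
  shows "x(n := s) \<in> profiles N C"
  using assms unfolding profiles_def by (auto simp: PiE_iff extensional_def)

lemma thresholds_image: "thresholds N C T = (\<lambda>(n, c). T n c) ` ({1..N} \<times> {1..C})"
  unfolding thresholds_def by force

lemma finite_thresholds: "finite (thresholds N C T)"
  unfolding thresholds_image by simp

lemma congestion_join:
  assumes "n \<in> {1..N}" "x n = 0" "c \<noteq> 0" "d \<noteq> 0"
  shows "congestion N (x(n := c)) d = congestion N x d + (if d = c then 1 else 0)"
proof (cases "d = c")
  case True
  have "{k \<in> {1..N}. (x(n := c)) k = d} = insert n {k \<in> {1..N}. x k = d}"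
    using assms True by auto
  moreover have "n \<notin> {k \<in> {1..N}. x k = d}" using assms by auto
  ultimately show ?thesis using True by (simp add: congestion_def)
next
  case False
  then have "{k \<in> {1..N}. (x(n := c)) k = d} = {k \<in> {1..N}. x k = d}"
    using assms by auto
  then show ?thesis using False by (simp add: congestion_def)
qed

text \<open>
  Joining a channel changes the potential by \<open>2 * (T - I) + 1\<close>, where \<open>I\<close> is the congestion after
  joining; the odd summand makes this positive also when \<open>I = T\<close>.
\<close>

definition potential :: "nat \<Rightarrow> nat \<Rightarrow> (nat \<Rightarrow> nat \<Rightarrow> nat) \<Rightarrow> (nat \<Rightarrow> nat) \<Rightarrow> int" where
  "potential N C T x =
     (\<Sum>n\<in>{1..N}. if x n = 0 then 0 else 2 * int (T n (x n)) + 1) -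
     (\<Sum>c\<in>{1..C}. int (congestion N x c) * (int (congestion N x c) + 1))"

lemma potential_join:
  assumes "n \<in> {1..N}" "x n = 0" "c \<in> {1..C}"
  shows "potential N C T (x(n := c)) =
           potential N C T x + 2 * (int (T n c) - int (congestion N (x(n := c)) c)) + 1"
proof -
  let ?y = "x(n := c)"
  let ?t = "\<lambda>x k. if x k = 0 then 0 else 2 * int (T k (x k)) + 1"
  let ?g = "\<lambda>x d. int (congestion N x d) * (int (congestion N x d) + 1)"
  have "sum (?t ?y) {1..N} = ?t ?y n + sum (?t ?y) ({1..N} - {n})"
    using assms by (intro sum.remove) auto
  also have "sum (?t ?y) ({1..N} - {n}) = sum (?t x) ({1..N} - {n})"
    by (intro sum.cong) auto
  also have "\<dots> = sum (?t x) {1..N}"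
    using assms by (subst sum.remove[of "{1..N}" n]) auto
  finally have t: "sum (?t ?y) {1..N} = 2 * int (T n c) + 1 + sum (?t x) {1..N}"
    using assms by auto
  have "sum (?g ?y) {1..C} = ?g ?y c + sum (?g ?y) ({1..C} - {c})"
    using assms by (intro sum.remove) auto
  also have "sum (?g ?y) ({1..C} - {c}) = sum (?g x) ({1..C} - {c})"
    using assms by (intro sum.cong) (auto simp: congestion_join)
  also have "\<dots> = sum (?g x) {1..C} - ?g x c"
    using assms by (subst sum.remove[of "{1..C}" c]) auto
  \<comment> \<open>Since \<open>i * (i + 1)\<close> is twice the sum of the first \<open>i\<close>
    positive integers, one more user raises this term by twice the congestion after joining.\<close>
  also have "?g ?y c + (sum (?g x) {1..C} - ?g x c)
      = sum (?g x) {1..C} + 2 * int (congestion N ?y c)"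
    using assms by (simp add: congestion_join algebra_simps)
  finally have g: "sum (?g ?y) {1..C} = sum (?g x) {1..C} + 2 * int (congestion N ?y c)" .
  show ?thesis unfolding potential_def t g by simp
qed

text \<open>A maximiser of the potential is an equilibrium, since any profitable move would reveal a
  profile of larger potential. Only joining and leaving a channel need analysis, never a switch
  between channels.\<close>

lemma nash_equilibria_nonempty: "nash_equilibria N C T \<noteq> {}"
proof -
  have "profiles N C \<noteq> {}" by (auto simp: profiles_def PiE_eq_empty_iff)
  then obtain x where x: "x \<in> profiles N C"
    and x_max: "\<And>y. y \<in> profiles N C \<Longrightarrow> potential N C T y \<le> potential N C T x"
    using finite_profiles[of N C] obtains_MAX[of "profiles N C" "potential N C T"]
    by (metis Max_ge finite_imageI image_eqI)
  have False
    if n: "n \<in> {1..N}" and s: "s \<in> {0..C}"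
      and better: "utility N T (x(n := s)) n > utility N T x n" for n s
  proof (cases "x n = 0")
    case True
    \<comment> \<open>A gain over 0 means utility 1, so the joined channel respects the threshold
      and the potential rises by at least 1.\<close>
    with better have "s \<noteq> 0" and "congestion N (x(n := s)) s \<le> T n s"
      by (auto simp: utility_def split: if_splits)
    with potential_join[of n N x s C T] x_max[OF profiles_update[OF x n s]] n s True
    show False by auto
  next
    case False
    \<comment> \<open>An active player can gain only from utility -1. Whatever \<open>s\<close> is,
      going dormant then raises the potential: \<open>x\<close> arises from \<open>?z\<close> by
      joining an overfull channel, which costs at least 1.\<close>
    let ?z = "x(n := 0)"
    have "x n \<in> {1..C}"
      using x n False by (auto simp: profiles_def PiE_iff Suc_le_eq)
    moreover have "congestion N x (x n) > T n (x n)"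
      using better False by (auto simp: utility_def split: if_splits)
    ultimately show False
      using potential_join[of n N ?z "x n" C T] x_max[OF profiles_update[OF x n, of 0]] n
      by auto
  qed
  with x have "x \<in> nash_equilibria N C T" unfolding nash_equilibria_def by blast
  then show ?thesis by blast
qed

text \<open>Dormant players have utility 0, so the group of strategy 0 drops out.\<close>

lemma welfare_by_channel:
  assumes "x \<in> profiles N C"
  shows "welfare N T x = (\<Sum>c\<in>{1..C}. \<Sum>n\<in>{n \<in> {1..N}. x n = c}. utility N T x n)"
proof -
  have "welfare N T x = (\<Sum>c\<in>{0..C}. \<Sum>n\<in>{n \<in> {1..N}. x n = c}. utility N T x n)"
    unfolding welfare_def using assms
    by (intro sum.group[symmetric]) (auto simp: profiles_def PiE_iff)
  also have "\<dots> = (\<Sum>c\<in>{1..C}. \<Sum>n\<in>{n \<in> {1..N}. x n = c}. utility N T x n)"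
    by (intro sum.mono_neutral_right) (auto simp: utility_def intro!: sum.neutral)
  finally show ?thesis .
qed

lemma welfare_le_players: "welfare N T x \<le> int N"
proof -
  have "welfare N T x \<le> (\<Sum>n\<in>{1..N}. 1)"
    unfolding welfare_def by (intro sum_mono) (auto simp: utility_def)
  then show ?thesis by simp
qed

text \<open>The bound holds channel by channel: up to \<open>M\<close> users contribute at most 1
  each, while more than \<open>M\<close> users are all unsatisfied.\<close>

lemma welfare_le_channels:
  assumes x: "x \<in> profiles N C" and M: "\<And>n c. n \<in> {1..N} \<Longrightarrow> c \<in> {1..C} \<Longrightarrow> T n c \<le> M"
  shows "welfare N T x \<le> int C * int M"
proof -
  have "(\<Sum>n\<in>{n \<in> {1..N}. x n = c}. utility N T x n) \<le> int M" if c: "c \<in> {1..C}" for c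
  proof (cases "congestion N x c \<le> M")
    case True
    have "(\<Sum>n\<in>{n \<in> {1..N}. x n = c}. utility N T x n) \<le> (\<Sum>n\<in>{n \<in> {1..N}. x n = c}. 1)"
      by (intro sum_mono) (auto simp: utility_def)
    with True show ?thesis by (simp add: congestion_def)
  next
    case False
    have "utility N T x n \<le> 0" if "n \<in> {n \<in> {1..N}. x n = c}" for n
      using that False M[of n c] c by (auto simp: utility_def)
    then have "(\<Sum>n\<in>{n \<in> {1..N}. x n = c}. utility N T x n) \<le> 0"
      by (rule sum_nonpos)
    then show ?thesis by simp
  qed
  then have "(\<Sum>c\<in>{1..C}. \<Sum>n\<in>{n \<in> {1..N}. x n = c}. utility N T x n) \<le> (\<Sum>c\<in>{1..C}. int M)"
    by (rule sum_mono)
  then show ?thesis by (simp add: welfare_by_channel[OF x])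
qed

text \<open>Dormancy is always available and guarantees 0, which rules out utility -1.\<close>

lemma nash_utility:
  assumes "x \<in> nash_equilibria N C T" "n \<in> {1..N}"
  shows "utility N T x n = (if x n = 0 then 0 else 1)"
proof -
  have "\<not> utility N T (x(n := 0)) n > utility N T x n"
    using assms by (auto simp: nash_equilibria_def)
  then show ?thesis by (auto simp: utility_def split: if_splits)
qed

lemma nash_welfare_ge:
  assumes x: "x \<in> nash_equilibria N C T"
    and m: "\<And>n c. n \<in> {1..N} \<Longrightarrow> c \<in> {1..C} \<Longrightarrow> m \<le> T n c"
  shows "min (int N) (int C * int m) \<le> welfare N T x"
proof (cases "\<exists>n\<in>{1..N}. x n = 0")
  case False
  then have "welfare N T x = (\<Sum>n\<in>{1..N}. 1)"
    unfolding welfare_def using nash_utility[OF x] by (intro sum.cong) auto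
  then show ?thesis by simp
next
  case True
  then obtain n where n: "n \<in> {1..N}" and "x n = 0" by blast
  have "int m \<le> (\<Sum>k\<in>{k \<in> {1..N}. x k = c}. utility N T x k)" if c: "c \<in> {1..C}" for c
  proof -
    have "\<not> utility N T (x(n := c)) n > utility N T x n"
      using x n c by (auto simp: nash_equilibria_def)
    then have "T n c < congestion N (x(n := c)) c"
      using c \<open>x n = 0\<close> by (auto simp: utility_def split: if_splits)
    \<comment> \<open>The entrant counts itself, so the strict bound after joining becomes a weak
      one before: at least \<open>T n c\<close> users are already on \<open>c\<close>.\<close>
    then have "m \<le> congestion N x c"
      using m[OF n c] c n \<open>x n = 0\<close> by (simp add: congestion_join)
    moreover have "(\<Sum>k\<in>{k \<in> {1..N}. x k = c}. utility N T x k) = (\<Sum>k\<in>{k \<in> {1..N}. x k = c}. 1)"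
      using c by (intro sum.cong) (auto simp: nash_utility[OF x])
    ultimately show ?thesis by (simp add: congestion_def)
  qed
  then have "(\<Sum>c\<in>{1..C}. int m) \<le> (\<Sum>c\<in>{1..C}. \<Sum>k\<in>{k \<in> {1..N}. x k = c}. utility N T x k)"
    by (rule sum_mono)
  moreover have "x \<in> profiles N C" using x by (simp add: nash_equilibria_def)
  ultimately show ?thesis by (simp add: welfare_by_channel)
qed

theorem theorem3:
  fixes N C :: nat and T :: "nat \<Rightarrow> nat \<Rightarrow> nat"
  assumes "qos_game N C T"
    and "\<forall>n\<in>{1..N}. \<forall>c\<in>{1..C}. T n c \<ge> 1"
  shows "price_of_anarchy N C T
           \<le> min (real N) (real (Max (thresholds N C T)) / real (Min (thresholds N C T)))"
proof -
  define M where "M = Max (thresholds N C T)"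
  define m where "m = Min (thresholds N C T)"
  define a where "a = Max (welfare N T ` profiles N C)"
  define b where "b = Min (welfare N T ` nash_equilibria N C T)"
  have N: "N \<ge> 1" and C: "C \<ge> 1" using assms(1) by (auto simp: qos_game_def)
  then have ne: "thresholds N C T \<noteq> {}" by (auto simp: thresholds_image)
  have bounds: "m \<le> T n c" "T n c \<le> M" if "n \<in> {1..N}" "c \<in> {1..C}" for n c
    using that finite_thresholds[of N C T] unfolding m_def M_def
    by (auto simp: thresholds_def intro!: Min_le Max_ge)
  have "m \<in> thresholds N C T" unfolding m_def by (intro Min_in finite_thresholds ne)
  then have m: "m \<ge> 1" using assms(2) by (auto simp: thresholds_def)
  have "m \<le> M" using bounds[of 1 1] N C by simp
  have sub: "nash_equilibria N C T \<subseteq> profiles N C" by (auto simp: nash_equilibria_def)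
  \<comment> \<open>The minimum is attained because an equilibrium exists.\<close>
  have "b \<in> welfare N T ` nash_equilibria N C T"
    unfolding b_def using nash_equilibria_nonempty finite_subset[OF sub finite_profiles]
    by (intro Min_in) auto
  then have b: "min (int N) (int C * int m) \<le> b" using nash_welfare_ge bounds(1) by blast
  have "a \<in> welfare N T ` profiles N C"
    unfolding a_def using sub nash_equilibria_nonempty[of N C T] finite_profiles
    by (intro Max_in) auto
  then have a: "a \<le> int N" "a \<le> int C * int M"
    using welfare_le_players welfare_le_channels bounds(2) by blast+
  \<comment> \<open>Both terms of the lower bound for \<open>b\<close> are thus at least 1, so
    division by \<open>b\<close> is genuine.\<close>
  have "int C * int m \<ge> 1" using C m by (metis mult_le_mono mult_1 of_nat_1 of_nat_le_iff of_nat_mult)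
  with b N have b_pos: "b \<ge> 1" by linarith
  have "a \<le> int N * b" using a(1) b_pos mult_left_mono[of 1 b "int N"] by simp
  then have "real_of_int a \<le> real N * real_of_int b"
    by (metis of_int_le_iff of_int_mult of_int_of_nat_eq)
  then have 1: "real_of_int a / real_of_int b \<le> real N"
    using b_pos by (simp add: pos_divide_le_eq)
  \<comment> \<open>This is the second bound with denominators cleared. If \<open>b\<close> reaches
    \<open>N\<close>, then \<open>a \<le> b\<close> and \<open>m \<le> M\<close> suffice; otherwise
    \<open>C * m \<le> b\<close>, and the factor \<open>C\<close> is shared with
    \<open>a \<le> C * M\<close>.\<close>
  have "a * int m \<le> int M * b"
  proof (cases "int N \<le> b")
    case True
    have "a * int m \<le> b * int m" using a(1) True by (intro mult_right_mono) auto
    also have "\<dots> \<le> b * int M" using b_pos \<open>m \<le> M\<close> by (intro mult_left_mono) auto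
    finally show ?thesis by (simp add: mult.commute)
  next
    case False
    have "a * int m \<le> int C * int M * int m" using a(2) by (intro mult_right_mono) auto
    also have "\<dots> = int M * (int C * int m)" by simp
    also have "\<dots> \<le> int M * b" using b False by (intro mult_left_mono) auto
    finally show ?thesis .
  qed
  then have "real_of_int a * real m \<le> real M * real_of_int b"
    by (metis of_int_le_iff of_int_mult of_int_of_nat_eq)
  then have "real_of_int a / real_of_int b \<le> real M / real m"
    using b_pos m by (simp add: field_simps)
  with 1 show ?thesis
    by (simp add: price_of_anarchy_def a_def b_def M_def m_def)
qed

end
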